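(* Let $d\ge 1$ be an integer, let $c\ge 0$ be an integer, and let $\mathcal F$ be a family of $n$ compact convex sets in $\mathbb R^d$ such that any point $x\in\mathbb R^d$ belongs to at most $c$ sets of $\mathcal F$. Suppose that $r$ is a positive integer and that $$ n\ge (d+1)(r-1)+c+1. $$ Then there exists a point $p\in\mathbb R^d$ such that for any ray $\rho$ starting at $p$ there are at least $r$ sets in $\mathcal F$ that $\rho$ does not intersect.
   Context: A point $p$ on a straight line $\ell\subset\mathbb R^d$ divides $\ell$ into two half-lines; these half-lines (including their endpoint $p$) are called rays starting at $p$. A family is understood as an indexed family: members may be repeated and are counted with multiplicity. *)

theory Defs
  imports "HOL-Analysis.Analysis"
begin

(* The line through p with direction v is {p + t v | t real}; since v ranges over all nonzero
   vectors (so v and -v both occur), both of its closed half-lines at p are rays. *)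
definition ray_from :: "'a::real_vector \<Rightarrow> 'a set \<Rightarrow> bool" where
  "ray_from p \<rho> \<longleftrightarrow> (\<exists>v. v \<noteq> 0 \<and> \<rho> = {p + t *\<^sub>R v | t. 0 \<le> t})"

end

theory Submission
  imports Defs
begin

text \<open>
  Fix a point \<open>p\<close> and let \<open>u\<^sub>i\<close> be the vector from \<open>p\<close> to its nearest point in the \<open>i\<close>-th set. If
  \<open>p\<close> lies outside that set and \<open>v \<bullet> u\<^sub>i \<le> 0\<close>, the ray from \<open>p\<close> in direction \<open>v\<close> misses the
  set (\<open>ray_misses_convex\<close>). So it is enough to find \<open>p\<close> such that every \<open>v\<close> satisfies
  \<open>v \<bullet> u\<^sub>i \<le> 0\<close> for at least \<open>r\<close> of the sets that do not contain \<open>p\<close>; that is, \<open>p\<close> should be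
  a center point of its own projections.

  For a fixed \<open>p\<close>, a center point of the projections exists by a Helly-type argument, and one
  expects a fixed point theorem to make it coincide with \<open>p\<close>. The obstruction is that the number
  of sets avoiding \<open>p\<close> jumps as \<open>p\<close> moves. Counting is therefore replaced by continuous weights
  \<open>w\<^sub>i = min 1 (k \<cdot> \<bar>u\<^sub>i\<bar>)\<close>, which vanish exactly on the \<open>i\<close>-th set. With \<open>d\<close> the dimension and
  \<open>s = r - 1\<close>, more than \<open>(d + 1) s\<close> sets avoid each point, and by compactness one \<open>k\<close> makes the
  total weight \<open>W\<close> exceed \<open>(d + 1) s\<close> on the whole convex hull \<open>B\<close> of the family
  (\<open>truncated_weights_exceed\<close>).

  Call \<open>v\<close> bad at \<open>p\<close> if the indices with \<open>v \<bullet> u\<^sub>i \<le> 0\<close> weigh less than \<open>W / (d + 1)\<close>. If no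
  \<open>v\<close> is bad at \<open>p\<close>, then for every \<open>v\<close> these indices weigh more than \<open>s\<close>; since \<open>w\<^sub>i \<le> 1\<close>, more
  than \<open>s\<close> of them have positive weight, and \<open>p\<close> is as required. Suppose instead that every point
  of \<open>B\<close> has a bad direction. Badness of \<open>v\<close> is an open condition on \<open>p\<close>
  (\<open>open_few_in_closed_halfspace\<close>), so Brouwer's theorem yields a point \<open>p\<close> of \<open>B\<close> and a convex
  combination \<open>v\<close> of directions bad at \<open>p\<close> that points out of \<open>B\<close>
  (\<open>outward_value_of_open_cover\<close>); in particular \<open>v \<bullet> u\<^sub>i \<le> 0\<close> for all \<open>i\<close>. By Caratheodory's
  theorem \<open>v\<close> is a combination of at most \<open>d + 1\<close> bad directions. Together they have too little
  weight in their closed half-spaces to exhaust \<open>W\<close>, so some \<open>u\<^sub>i\<close> has positive inner product with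
  all of them, hence with \<open>v\<close> (\<open>common_positive_halfspace\<close>): a contradiction.

  Empty members of the family are missed by every ray and are removed beforehand, because they
  have no nearest points.
\<close>

section \<open>A variational consequence of Brouwer's theorem\<close>

text \<open>
  A partition of unity subordinate to the cover turns the assignment of \<open>v\<close> to \<open>U v\<close> into a
  continuous vector field \<open>f\<close> on \<open>B\<close>. A fixed point \<open>p\<close> of the map that moves \<open>x\<close> by \<open>f x\<close> and
  projects back to \<open>B\<close> is one where \<open>f p\<close> lies in the outward normal cone of \<open>B\<close>.
\<close>

lemma outward_value_of_open_cover:
  fixes B :: "'a::euclidean_space set" and U :: "'a \<Rightarrow> 'a set"
  assumes B: "compact B" "convex B" "B \<noteq> {}"
    and U: "\<And>v. open (U v)" "B \<subseteq> (\<Union>v. U v)"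
  shows "\<exists>p\<in>B. \<exists>v\<in>convex hull {v. p \<in> U v}. \<forall>y\<in>B. v \<bullet> (y - p) \<le> 0"
proof -
  obtain V where V: "finite V" "B \<subseteq> (\<Union>v\<in>V. U v)"
    using compactE_image[OF B(1), of UNIV U] U by (metis UNIV_I)
  define C where "C = U ` V"
  have "finite C" using V(1) by (simp add: C_def)
  obtain g :: "'a set \<Rightarrow> 'a \<Rightarrow> real"
    where g: "\<And>T. T \<in> C \<Longrightarrow> continuous_on B (g T) \<and> (\<forall>x\<in>B. 0 \<le> g T x)"
      and g0: "\<And>x T. \<lbrakk>T \<in> C; x \<in> B; x \<notin> T\<rbrakk> \<Longrightarrow> g T x = 0"
      and g1: "\<And>x. x \<in> B \<Longrightarrow> supp_sum (\<lambda>T. g T x) C = 1"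
  proof (rule subordinate_partition_of_unity[of B C])
    show "B \<subseteq> \<Union>C" using V(2) by (simp add: C_def)
    show "open T" if "T \<in> C" for T using that U(1) by (auto simp: C_def)
    show "\<exists>N. open N \<and> x \<in> N \<and> finite {T \<in> C. T \<inter> N \<noteq> {}}" if "x \<in> B" for x
      using \<open>finite C\<close> by (intro exI[of _ UNIV]) auto
  qed blast
  have sum1: "(\<Sum>T\<in>C. g T x) = 1" if "x \<in> B" for x
  proof -
    have "supp_sum (\<lambda>T. g T x) C = (\<Sum>T\<in>C. g T x)"
      unfolding supp_sum_def support_on_def using \<open>finite C\<close> by (intro sum.mono_neutral_left) auto
    then show ?thesis using g1[OF that] by simp
  qed
  \<comment> \<open>Distinct vectors may have the same open set, so one representative per set is chosen.\<close>
  have "\<forall>T\<in>C. \<exists>v. U v = T" by (auto simp: C_def)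
  then obtain e where e: "\<And>T. T \<in> C \<Longrightarrow> U (e T) = T" by metis
  define f where "f x = (\<Sum>T\<in>C. g T x *\<^sub>R e T)" for x
  have f_hull: "f x \<in> convex hull {v. x \<in> U v}" if x: "x \<in> B" for x
  proof -
    let ?A = "{T \<in> C. x \<in> T}"
    have "f x = (\<Sum>T\<in>?A. g T x *\<^sub>R e T)"
      unfolding f_def using \<open>finite C\<close> g0 x by (intro sum.mono_neutral_right) auto
    also have "\<dots> \<in> convex hull {v. x \<in> U v}"
    proof (rule convex_sum)
      have "(\<Sum>T\<in>?A. g T x) = (\<Sum>T\<in>C. g T x)"
        using \<open>finite C\<close> g0 x by (intro sum.mono_neutral_left) auto
      then show "(\<Sum>T\<in>?A. g T x) = 1" using sum1[OF x] by simp
    qed (use \<open>finite C\<close> g x e in \<open>auto intro!: hull_inc\<close>)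
    finally show ?thesis .
  qed
  have "continuous_on B f"
    unfolding f_def using g by (intro continuous_intros) auto
  then have cont: "continuous_on B (\<lambda>x. closest_point B (x + f x))"
    using B by (intro continuous_on_compose2[OF continuous_on_closest_point[of B UNIV]])
      (auto intro!: continuous_intros compact_imp_closed)
  obtain p where p: "p \<in> B" "closest_point B (p + f p) = p"
    using brouwer[OF B cont] closest_point_in_set[OF compact_imp_closed[OF B(1)] B(3)] by blast
  have "f p \<bullet> (y - p) \<le> 0" if "y \<in> B" for y
    using closest_point_dot[OF B(2) compact_imp_closed[OF B(1)] that, of "p + f p"] p(2) by simp
  then show ?thesis using p(1) f_hull by blast
qed

section \<open>Weighted vectors in half-spaces\<close>

text \<open>
  The Helly-type counting step. At most \<open>DIM('a) + 1\<close> of the vectors \<open>v\<close> suffice to represent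
  \<open>x\<close>, and the sets of indices that they exclude have total weight less than \<open>sum w I\<close>. An index
  that none of them excludes survives taking convex combinations.
\<close>

lemma common_positive_halfspace:
  fixes u :: "'i \<Rightarrow> 'a::euclidean_space" and w :: "'i \<Rightarrow> real"
  assumes I: "finite I" and w: "\<And>i. i \<in> I \<Longrightarrow> 0 \<le> w i"
    and V: "\<And>v. v \<in> V \<Longrightarrow> real (DIM('a) + 1) * (\<Sum>i\<in>{i\<in>I. v \<bullet> u i \<le> 0}. w i) < sum w I"
    and x: "x \<in> convex hull V"
  obtains i where "i \<in> I" "0 < x \<bullet> u i"
proof -
  obtain S where S: "finite S" "S \<subseteq> V" "card S \<le> DIM('a) + 1" "x \<in> convex hull S"
    using x unfolding caratheodory[of V] by blast
  have "S \<noteq> {}" using S(4) by auto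
  let ?b = "\<lambda>v. {i\<in>I. v \<bullet> u i \<le> 0}"
  have "\<exists>i\<in>I. \<forall>v\<in>S. 0 < v \<bullet> u i"
  proof (rule ccontr)
    assume no: "\<not> ?thesis"
    then obtain v0 where "v0 \<in> S" using \<open>S \<noteq> {}\<close> by blast
    then have pos: "0 < sum w I"
    proof -
      have "0 \<le> real (DIM('a) + 1) * sum w (?b v0)"
        by (intro mult_nonneg_nonneg sum_nonneg) (auto intro: w)
      also have "\<dots> < sum w I" using V \<open>v0 \<in> S\<close> S(2) by blast
      finally show ?thesis .
    qed
    have "w i \<le> (\<Sum>v\<in>S. if v \<bullet> u i \<le> 0 then w i else 0)" if i: "i \<in> I" for i
    proof -
      obtain v where v: "v \<in> S" "v \<bullet> u i \<le> 0" using no i by (auto simp: not_less)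
      then show ?thesis
        using member_le_sum[of v S "\<lambda>v. if v \<bullet> u i \<le> 0 then w i else 0"] S(1) w[OF i] by auto
    qed
    then have "sum w I \<le> (\<Sum>i\<in>I. \<Sum>v\<in>S. if v \<bullet> u i \<le> 0 then w i else 0)"
      by (rule sum_mono)
    also have "\<dots> = (\<Sum>v\<in>S. sum w (?b v))"
      using I by (subst sum.swap) (simp add: sum.inter_filter)
    also have "\<dots> < (\<Sum>v\<in>S. sum w I / (DIM('a) + 1))"
      using S(1,2) \<open>S \<noteq> {}\<close> V by (intro sum_strict_mono) (auto simp: field_simps)
    also have "\<dots> = card S / (DIM('a) + 1) * sum w I" by simp
    also have "\<dots> \<le> 1 * sum w I"
      using S(3) pos by (intro mult_right_mono) auto
    finally show False by simp
  qed
  then obtain i where i: "i \<in> I" "S \<subseteq> {v. 0 < u i \<bullet> v}" by (auto simp: inner_commute)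
  then have "x \<in> {v. 0 < u i \<bullet> v}"
    using hull_minimal[of S _ convex] convex_halfspace_gt[of 0 "u i"] S(4) by blast
  then show ?thesis using that i(1) by (simp add: inner_commute)
qed

text \<open>
  As \<open>q\<close> varies, the sum may jump because its index set changes. Strict positivity of
  \<open>v \<bullet> u i q\<close> persists nearby, however, so jumps upwards do not occur. Summing over the complement
  of a fixed set \<open>P\<close> of strictly positive indices only increases the sum, which exhibits the
  set as a union, over all \<open>P\<close>, of sets given by strict inequalities between continuous functions.
\<close>

lemma open_few_in_closed_halfspace:
  fixes u :: "'i \<Rightarrow> 'a::real_inner \<Rightarrow> 'a" and w :: "'i \<Rightarrow> 'a \<Rightarrow> real"
  assumes I: "finite I" and w: "\<And>i q. i \<in> I \<Longrightarrow> 0 \<le> w i q"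
    and cont: "\<And>i. i \<in> I \<Longrightarrow> continuous_on UNIV (u i)" "\<And>i. i \<in> I \<Longrightarrow> continuous_on UNIV (w i)"
    and a: "0 \<le> a"
  shows "open {q. a * (\<Sum>i\<in>{i\<in>I. v \<bullet> u i q \<le> 0}. w i q) < (\<Sum>i\<in>I. w i q)}"
    (is "open ?U")
proof -
  let ?N = "\<lambda>P. {q. (\<forall>i\<in>P. 0 < v \<bullet> u i q) \<and> a * (\<Sum>i\<in>I - P. w i q) < (\<Sum>i\<in>I. w i q)}"
  have "?U = (\<Union>P\<in>Pow I. ?N P)"
  proof (intro subset_antisym subsetI)
    fix q assume q: "q \<in> ?U"
    have "I - {i\<in>I. 0 < v \<bullet> u i q} = {i\<in>I. v \<bullet> u i q \<le> 0}" by auto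
    then have "q \<in> ?N {i\<in>I. 0 < v \<bullet> u i q}" using q by simp
    then show "q \<in> (\<Union>P\<in>Pow I. ?N P)" by (rule UN_I[rotated]) simp
  next
    fix q assume "q \<in> (\<Union>P\<in>Pow I. ?N P)"
    then obtain P where P: "P \<subseteq> I" "q \<in> ?N P" by (elim UN_E) (simp only: Pow_iff)
    have "(\<Sum>i\<in>{i\<in>I. v \<bullet> u i q \<le> 0}. w i q) \<le> (\<Sum>i\<in>I - P. w i q)"
      using I w P by (intro sum_mono2) fastforce+
    then have "a * (\<Sum>i\<in>{i\<in>I. v \<bullet> u i q \<le> 0}. w i q) \<le> a * (\<Sum>i\<in>I - P. w i q)"
      using a by (rule mult_left_mono)
    then show "q \<in> ?U" using P by simp
  qed
  moreover have "open (?N P)" if "P \<subseteq> I" for P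
  proof (intro open_Collect_conj open_Collect_less)
    have "{q. \<forall>i\<in>P. 0 < v \<bullet> u i q} = (\<Inter>i\<in>P. {q. 0 < v \<bullet> u i q})" by auto
    then show "open {q. \<forall>i\<in>P. 0 < v \<bullet> u i q}"
      using that I cont by (auto intro!: open_INT open_Collect_less continuous_intros finite_subset[of P I])
  qed (use that cont in \<open>auto intro!: continuous_intros\<close>)
  ultimately show ?thesis by auto
qed

text \<open>
  The sum of truncations increases with \<open>k\<close> and eventually reaches the number of indices with
  \<open>0 < d i x\<close>; compactness makes the choice of \<open>k\<close> uniform in \<open>x\<close>.
\<close>

lemma truncated_weights_exceed:
  fixes d :: "'i \<Rightarrow> 'a::topological_space \<Rightarrow> real"
  assumes B: "compact B" and I: "finite I"
    and d: "\<And>i. i \<in> I \<Longrightarrow> continuous_on UNIV (d i)" "\<And>i x. i \<in> I \<Longrightarrow> 0 \<le> d i x"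
    and m: "\<And>x. x \<in> B \<Longrightarrow> m < real (card {i\<in>I. 0 < d i x})"
  obtains k :: nat where "\<And>x. x \<in> B \<Longrightarrow> m < (\<Sum>i\<in>I. min 1 (real k * d i x))"
proof -
  let ?W = "\<lambda>(k::nat) x. \<Sum>i\<in>I. min 1 (real k * d i x)"
  have mono: "?W j x \<le> ?W k x" if "j \<le> k" for j k x
    using that d(2) by (intro sum_mono min.mono mult_right_mono) auto
  have "\<exists>k. m < ?W k x" if x: "x \<in> B" for x
  proof -
    let ?J = "{i\<in>I. 0 < d i x}"
    have "\<exists>k. \<forall>i\<in>?J. 1 \<le> real k * d i x"
    proof -
      obtain k :: nat where k: "(\<Sum>i\<in>?J. 1 / d i x) \<le> real k" using real_arch_simple by blast
      have "1 \<le> real k * d i x" if "i \<in> ?J" for i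
      proof -
        have "1 / d i x \<le> (\<Sum>i\<in>?J. 1 / d i x)"
          using that I by (intro member_le_sum) auto
        then have "1 / d i x \<le> real k" using k by simp
        then show ?thesis using that by (simp add: field_simps)
      qed
      then show ?thesis by blast
    qed
    then obtain k where k: "\<And>i. i \<in> ?J \<Longrightarrow> 1 \<le> real k * d i x" by blast
    have "real (card ?J) = (\<Sum>i\<in>?J. min 1 (real k * d i x))" using k by (simp add: min_absorb1)
    also have "\<dots> \<le> ?W k x" using I d(2) by (intro sum_mono2) auto
    finally show ?thesis using m[OF x] by (intro exI[of _ k]) simp
  qed
  then have cover: "B \<subseteq> (\<Union>k. {x. m < ?W k x})" by blast
  have op: "open {x. m < ?W k x}" for k
    using d by (intro open_Collect_less) (auto intro!: continuous_intros)
  obtain N where N: "finite N" "B \<subseteq> (\<Union>k\<in>N. {x. m < ?W k x})"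
    using compactE_image[OF B, of UNIV "\<lambda>k. {x. m < ?W k x}"] op cover by (metis UNIV_I)
  show ?thesis
  proof (rule that[of "Max (insert 0 N)"])
    fix x assume "x \<in> B"
    then obtain j where "j \<in> N" "m < ?W j x" using N(2) by blast
    then show "m < ?W (Max (insert 0 N)) x"
      using mono[of j "Max (insert 0 N)" x] N(1) by simp
  qed
qed

section \<open>Points whose rays miss many sets\<close>

text \<open>
  The set lies in the closed half-space beyond the nearest point to \<open>p\<close>, and a ray whose direction
  has no positive component towards that point never reaches the half-space.
\<close>

lemma ray_misses_convex:
  fixes K :: "'a::euclidean_space set"
  assumes K: "convex K" "closed K" and p: "p \<notin> K"
    and v: "v \<bullet> (closest_point K p - p) \<le> 0"
  shows "{p + t *\<^sub>R v | t. 0 \<le> t} \<inter> K = {}"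
proof (rule ccontr)
  assume "\<not> ?thesis"
  then obtain t where t: "0 \<le> t" "p + t *\<^sub>R v \<in> K" by auto
  let ?u = "closest_point K p - p"
  have "?u \<noteq> 0"
  proof
    assume "?u = 0"
    moreover have "closest_point K p \<in> K" using closest_point_in_set[OF K(2)] t(2) by blast
    ultimately show False using p by simp
  qed
  have "(- ?u) \<bullet> (t *\<^sub>R v - ?u) \<le> 0"
    using closest_point_dot[OF K t(2), of p] by (simp add: algebra_simps)
  then have "?u \<bullet> ?u \<le> t * (v \<bullet> ?u)" by (simp add: algebra_simps inner_commute)
  also have "\<dots> \<le> 0" using t v by (simp add: mult_nonneg_nonpos)
  finally show False using \<open>?u \<noteq> 0\<close> inner_gt_zero_iff[of ?u] by linarith
qed

text \<open>
  The core of the argument, for sets with nearest points. A degenerate direction \<open>v = 0\<close> may be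
  included here: the half-space condition that is proved covers it, too.
\<close>

lemma dual_center_point_nonempty:
  fixes F :: "'i \<Rightarrow> 'a::euclidean_space set"
  assumes I: "finite I"
    and F: "\<And>i. i \<in> I \<Longrightarrow> compact (F i)" "\<And>i. i \<in> I \<Longrightarrow> convex (F i)" "\<And>i. i \<in> I \<Longrightarrow> F i \<noteq> {}"
    and c: "\<And>x. card {i \<in> I. x \<in> F i} \<le> c"
    and n: "(DIM('a) + 1) * s + c < card I"
  shows "\<exists>p. \<forall>v. s < card {i \<in> I. {p + t *\<^sub>R v | t. 0 \<le> t} \<inter> F i = {}}"
proof -
  define u where "u i x = closest_point (F i) x - x" for i x
  define B where "B = convex hull (\<Union>i\<in>I. F i)"
  have "I \<noteq> {}" using n by auto
  have FB: "F i \<subseteq> B" if "i \<in> I" for i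
    using hull_subset[of "\<Union>i\<in>I. F i" convex] that unfolding B_def by blast
  have "B \<noteq> {}" using FB F(3) \<open>I \<noteq> {}\<close> by blast
  moreover have "compact B" "convex B"
    unfolding B_def using I F(1) by (auto intro: compact_convex_hull compact_UN)
  ultimately have B: "compact B" "convex B" "B \<noteq> {}" by blast+
  have closed: "closed (F i)" if "i \<in> I" for i using F(1)[OF that] by (rule compact_imp_closed)
  have proj: "closest_point (F i) x \<in> F i" if "i \<in> I" for i x
    by (rule closest_point_in_set[OF closed[OF that] F(3)[OF that]])
  have u_cont: "continuous_on UNIV (u i)" if "i \<in> I" for i
    unfolding u_def
    by (intro continuous_on_diff continuous_on_id
        continuous_on_closest_point[OF F(2)[OF that] closed[OF that] F(3)[OF that]])
  have u0: "u i x = 0 \<longleftrightarrow> x \<in> F i" if "i \<in> I" for i x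
  proof
    show "x \<in> F i" if "u i x = 0" using proj[OF \<open>i \<in> I\<close>, of x] that by (simp add: u_def)
    show "u i x = 0" if "x \<in> F i" using closest_point_self[OF that] by (simp add: u_def)
  qed
  have many: "real ((DIM('a) + 1) * s) < real (card {i\<in>I. 0 < norm (u i x)})" for x
  proof -
    have "{i\<in>I. 0 < norm (u i x)} = I - {i\<in>I. x \<in> F i}" using u0 by auto
    then have "card {i\<in>I. 0 < norm (u i x)} = card I - card {i\<in>I. x \<in> F i}"
      using I by (simp add: card_Diff_subset)
    then show ?thesis using c[of x] n by linarith
  qed
  \<comment> \<open>More than \<open>(DIM('a) + 1) * s\<close> sets avoid each point; the weights inherit this bound on \<open>B\<close>.\<close>
  obtain k :: nat where k: "\<And>x. x \<in> B \<Longrightarrow>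
      real ((DIM('a) + 1) * s) < (\<Sum>i\<in>I. min 1 (real k * norm (u i x)))"
    by (rule truncated_weights_exceed[OF B(1) I, of "\<lambda>i x. norm (u i x)" "real ((DIM('a) + 1) * s)"])
      (use many in \<open>auto intro: continuous_on_norm[OF u_cont]\<close>)
  define w where "w i x = min 1 (real k * norm (u i x))" for i x
  have w: "0 \<le> w i x" "w i x \<le> 1" for i x by (auto simp: w_def)
  have w0: "w i x = 0" if "i \<in> I" "x \<in> F i" for i x
    using u0[OF that(1), of x] that(2) by (simp add: w_def)
  have w_cont: "continuous_on UNIV (w i)" if "i \<in> I" for i
    unfolding w_def using u_cont[OF that] by (intro continuous_intros)
  define U where "U v = {q. real (DIM('a) + 1) * (\<Sum>i\<in>{i\<in>I. v \<bullet> u i q \<le> 0}. w i q)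
      < (\<Sum>i\<in>I. w i q)}" for v
  have U_open: "open (U v)" for v
    unfolding U_def by (intro open_few_in_closed_halfspace I w u_cont w_cont) auto
  \<comment> \<open>An outward vector at \<open>p\<close> cannot point towards any nearest point, as these all lie in \<open>B\<close>.\<close>
  have "\<not> B \<subseteq> (\<Union>v. U v)"
  proof
    assume "B \<subseteq> (\<Union>v. U v)"
    from outward_value_of_open_cover[where U = U, OF B U_open this]
    obtain p v where pv: "p \<in> B" "v \<in> convex hull {v. p \<in> U v}"
        "\<forall>y\<in>B. v \<bullet> (y - p) \<le> 0"
      by blast
    obtain i where i: "i \<in> I" "0 < v \<bullet> u i p"
      by (rule common_positive_halfspace[OF I _ _ pv(2), of "\<lambda>i. w i p" "\<lambda>i. u i p"])
        (use w in \<open>auto simp: U_def\<close>)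
    have "v \<bullet> u i p \<le> 0"
      unfolding u_def by (intro bspec[OF pv(3)] subsetD[OF FB[OF i(1)]] proj[OF i(1)])
    then show False using i(2) by simp
  qed
  then obtain p where p: "p \<in> B" "\<And>v. p \<notin> U v" by blast
  have "s < card {i \<in> I. {p + t *\<^sub>R v | t. 0 \<le> t} \<inter> F i = {}}" for v
  proof -
    let ?b = "{i\<in>I. v \<bullet> u i p \<le> 0}" and ?b' = "{i\<in>I. v \<bullet> u i p \<le> 0 \<and> p \<notin> F i}"
    have "real (DIM('a) + 1) * real s < real (DIM('a) + 1) * (\<Sum>i\<in>?b. w i p)"
    proof -
      have "real (DIM('a) + 1) * real s < (\<Sum>i\<in>I. w i p)"
        using k[OF p(1)] unfolding w_def of_nat_mult .
      also have "\<dots> \<le> real (DIM('a) + 1) * (\<Sum>i\<in>?b. w i p)"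
        using p(2)[of v] unfolding U_def mem_Collect_eq not_less .
      finally show ?thesis .
    qed
    then have "real s < (\<Sum>i\<in>?b. w i p)" by (rule mult_left_less_imp_less) simp
    \<comment> \<open>Sets that contain \<open>p\<close> satisfy the half-space condition but carry no weight.\<close>
    also have "\<dots> = (\<Sum>i\<in>?b'. w i p)"
      using I w0 by (intro sum.mono_neutral_right) auto
    also have "\<dots> \<le> real (card ?b')" using sum_bounded_above[of ?b' "\<lambda>i. w i p" 1] w by simp
    finally have "s < card ?b'" by simp
    also have "\<dots> \<le> card {i \<in> I. {p + t *\<^sub>R v | t. 0 \<le> t} \<inter> F i = {}}"
    proof (intro card_mono Collect_mono)
      show "i \<in> I \<and> v \<bullet> u i p \<le> 0 \<and> p \<notin> F i \<longrightarrow>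
          i \<in> I \<and> {p + t *\<^sub>R v | t. 0 \<le> t} \<inter> F i = {}" for i
        using ray_misses_convex[OF F(2) closed] unfolding u_def by blast
    qed (use I in simp)
    finally show ?thesis .
  qed
  then show ?thesis by blast
qed

text \<open>
  Every ray misses each empty member. Discarding \<open>e \<le> s\<close> of them lowers \<open>card I\<close> and \<open>s\<close> by
  \<open>e\<close>, and the hypothesis survives because \<open>s\<close> is multiplied by \<open>DIM('a) + 1 \<ge> 1\<close>.
\<close>

lemma dual_center_point:
  fixes F :: "'i \<Rightarrow> 'a::euclidean_space set"
  assumes I: "finite I"
    and F: "\<And>i. i \<in> I \<Longrightarrow> compact (F i)" "\<And>i. i \<in> I \<Longrightarrow> convex (F i)"
    and c: "\<And>x. card {i \<in> I. x \<in> F i} \<le> c"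
    and n: "(DIM('a) + 1) * s + c < card I"
  shows "\<exists>p. \<forall>v. s < card {i \<in> I. {p + t *\<^sub>R v | t. 0 \<le> t} \<inter> F i = {}}"
proof -
  define E where "E = {i\<in>I. F i = {}}"
  define J where "J = {i\<in>I. F i \<noteq> {}}"
  have fin: "finite E" "finite J" using I by (auto simp: E_def J_def)
  have card_I: "card I = card E + card J"
    using fin by (subst card_Un_disjoint[symmetric])
      (auto simp: E_def J_def intro!: arg_cong[of _ _ card])
  have split: "card {i \<in> I. R \<inter> F i = {}} = card E + card {i \<in> J. R \<inter> F i = {}}" for R
    using fin I by (subst card_Un_disjoint[symmetric])
      (auto simp: E_def J_def intro!: arg_cong[of _ _ card])
  show ?thesis
  proof (cases "s < card E")
    case True
    then show ?thesis unfolding split by (auto intro: trans_less_add1)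
  next
    case False
    have "card {i \<in> J. x \<in> F i} \<le> c" for x
      using c[of x] by (auto simp: J_def elim!: order_trans[rotated] intro!: card_mono I)
    moreover have "(DIM('a) + 1) * (s - card E) + c < card J"
    proof -
      obtain t where "s = card E + t" using False by (metis not_less le_Suc_ex)
      then show ?thesis using n card_I by (simp add: algebra_simps)
    qed
    ultimately have
        "\<exists>p. \<forall>v. s - card E < card {i \<in> J. {p + t *\<^sub>R v | t. 0 \<le> t} \<inter> F i = {}}"
      using F by (intro dual_center_point_nonempty[OF fin(2)]) (auto simp: J_def)
    then show ?thesis unfolding split using False by (simp add: less_diff_conv2 add.commute)
  qed
qed

theorem corollary2:
  fixes F :: "'i \<Rightarrow> (real ^ 'd) set"
    and I :: "'i set"
    and n c r :: nat
  assumes "finite I"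
    and "card I = n"
    and "\<And>i. i \<in> I \<Longrightarrow> compact (F i)"
    and "\<And>i. i \<in> I \<Longrightarrow> convex (F i)"
    and "\<And>x. card {i \<in> I. x \<in> F i} \<le> c"
    and "r \<ge> 1"
    and "n \<ge> (CARD('d) + 1) * (r - 1) + c + 1"
  shows "\<exists>p. \<forall>\<rho>. ray_from p \<rho> \<longrightarrow> r \<le> card {i \<in> I. \<rho> \<inter> F i = {}}"
proof -
  have "(DIM(real ^ 'd) + 1) * (r - 1) + c < card I" using assms(2,7) by simp
  then obtain p where
      p: "\<And>v. r - 1 < card {i \<in> I. {p + t *\<^sub>R v | t. 0 \<le> t} \<inter> F i = {}}"
    using dual_center_point[OF assms(1,3,4,5)] by blast
  have "r \<le> card {i \<in> I. \<rho> \<inter> F i = {}}" if ray: "ray_from p \<rho>" for \<rho>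
  proof -
    obtain v where "\<rho> = {p + t *\<^sub>R v | t. 0 \<le> t}" using ray unfolding ray_from_def by blast
    then show ?thesis using p[of v] by simp
  qed
  then show ?thesis by blast
qed

end
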